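(* Let $G$ be a finite group and $S\subseteq G$ a symmetric generating set of $G$ not containing the identity, closed under conjugation, with $|S|=d$. Suppose the Cayley sum graph $C_\Sigma(G,S)$ is an $\varepsilon$-vertex expander for some $\varepsilon>0$, is not bipartite, and no symmetric set $T$ with $\emptyset\ne T\subsetneq S$ generates $G$. Let $(\kappa,d_0)$ be any one of the pairs $(477,3)$, $(330,4)$, $(257,5)$, $(214,6)$, $(187,7)$, $(167,8)$, $(153,9)$, $(142,10)$. If $d\ge d_0$, then every eigenvalue of the normalised adjacency matrix of $C_\Sigma(G,S)$ is greater than $-1+\frac{\varepsilon^4}{\kappa d^8}$.
   Context: The Cayley sum graph $C_\Sigma(G,S)$ has vertex set $G$, and $h$ is adjacent to $g$ iff $gh\in S$ (undirected; loops allowed). Its adjacency matrix has $A_{g,h}=1$ if $gh\in S$ and $0$ otherwise; the normalised adjacency matrix is this matrix divided by $d$. The graph is an $\varepsilon$-vertex expander if $|X^{-1}S\setminus X|\ge\varepsilon|X|$ for every nonempty $X\subseteq G$ with $|X|\le\frac12|G|$. A graph is bipartite if its vertex set is a union of two disjoint sets each containing no edge (in particular no loop). *)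

theory Defs
  imports "HOL-Algebra.Coset" "HOL-Algebra.Generated_Groups" "Jordan_Normal_Form.Char_Poly"
begin

definition symmetric_subset :: "('a, 'b) monoid_scheme \<Rightarrow> 'a set \<Rightarrow> bool" where
  "symmetric_subset G S \<longleftrightarrow> S \<subseteq> carrier G \<and> set_inv\<^bsub>G\<^esub> S = S"

definition conj_closed :: "('a, 'b) monoid_scheme \<Rightarrow> 'a set \<Rightarrow> bool" where
  "conj_closed G S \<longleftrightarrow> (\<forall>g\<in>carrier G. \<forall>s\<in>S. g \<otimes>\<^bsub>G\<^esub> s \<otimes>\<^bsub>G\<^esub> inv\<^bsub>G\<^esub> g \<in> S)"

text \<open>Graphs on a vertex set are given by their adjacency relation; a loop at \<open>g\<close> is the
  pair \<open>(g, g)\<close>.\<close>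

definition cayley_sum_graph :: "('a, 'b) monoid_scheme \<Rightarrow> 'a set \<Rightarrow> ('a \<times> 'a) set" where
  "cayley_sum_graph G S = {(g, h). g \<in> carrier G \<and> h \<in> carrier G \<and> g \<otimes>\<^bsub>G\<^esub> h \<in> S}"

definition bipartite :: "'a set \<Rightarrow> ('a \<times> 'a) set \<Rightarrow> bool" where
  "bipartite V E \<longleftrightarrow> (\<exists>A B. A \<union> B = V \<and> A \<inter> B = {} \<and>
     E \<inter> (A \<times> A) = {} \<and> E \<inter> (B \<times> B) = {})"

text \<open>The neighbours of \<open>X\<close> in the Cayley sum graph form the set \<open>X\<close>-inverse times \<open>S\<close>.\<close>

definition cayley_sum_vertex_expander ::
    "('a, 'b) monoid_scheme \<Rightarrow> 'a set \<Rightarrow> real \<Rightarrow> bool" where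
  "cayley_sum_vertex_expander G S \<epsilon> \<longleftrightarrow>
     (\<forall>X. X \<subseteq> carrier G \<and> X \<noteq> {} \<and> real (card X) \<le> 1 / 2 * real (card (carrier G)) \<longrightarrow>
        real (card ((set_inv\<^bsub>G\<^esub> X <#>\<^bsub>G\<^esub> S) - X)) \<ge> \<epsilon> * real (card X))"

text \<open>Library matrices have rows and columns indexed by natural numbers, so the matrix of a graph
  is taken with respect to an enumeration \<open>e\<close> of its \<open>n\<close> vertices.\<close>

definition adjacency_mat :: "nat \<Rightarrow> (nat \<Rightarrow> 'a) \<Rightarrow> ('a \<times> 'a) set \<Rightarrow> real mat" where
  "adjacency_mat n e E = mat n n (\<lambda>(i, j). if (e i, e j) \<in> E then 1 else 0)"

definition normalised_adjacency_mat ::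
    "nat \<Rightarrow> nat \<Rightarrow> (nat \<Rightarrow> 'a) \<Rightarrow> ('a \<times> 'a) set \<Rightarrow> real mat" where
  "normalised_adjacency_mat d n e E = (1 / real d) \<cdot>\<^sub>m adjacency_mat n e E"

end

theory Submission
  imports Defs
begin

text \<open>An eigenvalue close to \<open>-1\<close> yields, by the sweep cut of the dual Cheeger inequality, disjoint
  sets \<open>L\<close>, \<open>R\<close> almost all of whose incident edges run between \<open>L\<close> and \<open>R\<close>. By expansion
  \<open>L \<union> R\<close> is nearly everything and both sets have density about \<open>1/2\<close>. Since \<open>S\<close> is closed under
  conjugation, \<open>(g L, R g\<inverse>)\<close> is an equally good pair for every \<open>g\<close>, so
  \<open>(L \<inter> g L) \<union> (R \<inter> R g\<inverse>)\<close> has small edge boundary and is, again by expansion, nearly empty or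
  nearly everything. Hence \<open>L\<close> is close to a coset of a subgroup \<open>H\<close> of index two. As few edges lie
  inside \<open>L\<close>, \<open>S\<close> misses \<open>H\<close>, and \<open>H\<close> with its complement is a bipartition. This contradicts
  non-bipartiteness as soon as \<open>\<mu> + 1 < 2 (\<epsilon> / (200 d))\<^sup>2\<close>; the stated bound is
  weaker because \<open>\<epsilon> \<le> 2\<close> and \<open>d \<ge> 3\<close>.\<close>

section \<open>Two inequalities over the reals for the sweep cut\<close>

text \<open>Discrete form of writing the sum as an integral over thresholds \<open>t\<close> of the
  level sums. The induction removes an index where \<open>b\<close> attains its minimum
  \<open>m\<close> and lowers the others by \<open>m\<close>, so that level \<open>t\<close> becomes
  level \<open>t + m\<close>. The sweep cut uses the contrapositive: a negative weighted sum yields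
  a threshold with negative level sum.\<close>

lemma layer_cake_nonneg:
  fixes b c :: "'i \<Rightarrow> real"
  assumes "finite I" and "\<And>i. i \<in> I \<Longrightarrow> 0 \<le> b i"
    and "\<And>t. 0 \<le> t \<Longrightarrow> 0 \<le> (\<Sum>i\<in>I. if t < b i then c i else 0)"
  shows "0 \<le> (\<Sum>i\<in>I. c i * b i)"
  using assms
proof (induction I arbitrary: b rule: finite_psubset_induct)
  case (psubset I)
  show ?case
  proof (cases "I = {}")
    case False
    define m where "m = Min (b ` I)"
    have "m \<in> b ` I" using psubset.hyps False unfolding m_def by (intro Min_in) auto
    then obtain k where k: "k \<in> I" "b k = m" by blast
    have m_le: "m \<le> b i" if "i \<in> I" for i
      using that psubset.hyps unfolding m_def by simp
    have m0: "0 \<le> m" using psubset.prems(1) k by auto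
    have rest: "0 \<le> (\<Sum>i\<in>I - {k}. c i * (b i - m))"
    proof (rule psubset.IH)
      show "I - {k} \<subset> I" using k by auto
      show "0 \<le> b i - m" if "i \<in> I - {k}" for i using m_le that by auto
      fix t :: real assume "0 \<le> t"
      have "0 \<le> (\<Sum>i\<in>I. if t + m < b i then c i else 0)"
        using psubset.prems(2)[of "t + m"] \<open>0 \<le> t\<close> m0 by simp
      also have "\<dots> = (\<Sum>i\<in>I - {k}. if t + m < b i then c i else 0)"
        using k \<open>0 \<le> t\<close> psubset.hyps by (subst sum.remove[of _ k]) auto
      finally show "0 \<le> (\<Sum>i\<in>I - {k}. if t < b i - m then c i else 0)"
        by (simp add: less_diff_eq)
    qed
    have "(\<Sum>i\<in>I. c i * b i) = (\<Sum>i\<in>I. c i * (b i - m)) + m * (\<Sum>i\<in>I. c i)"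
      by (simp add: algebra_simps sum_subtractf sum_distrib_left)
    also have "(\<Sum>i\<in>I. c i * (b i - m)) = (\<Sum>i\<in>I - {k}. c i * (b i - m))"
      using k psubset.hyps by (subst sum.remove[of _ k]) auto
    finally have eq: "(\<Sum>i\<in>I. c i * b i) = (\<Sum>i\<in>I - {k}. c i * (b i - m)) + m * (\<Sum>i\<in>I. c i)" .
    have "0 \<le> m * (\<Sum>i\<in>I. c i)"
    proof (cases "m = 0")
      case False
      then have "(\<Sum>i\<in>I. if 0 < b i then c i else 0) = (\<Sum>i\<in>I. c i)"
        using m0 m_le by (intro sum.cong) force+
      then show ?thesis using psubset.prems(2)[of 0] m0 by simp
    qed simp
    then show ?thesis using eq rest by simp
  qed simp
qed

text \<open>Put \<open>u = \<bar>a + b\<bar>\<close> and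
  \<open>v = \<bar>a\<bar> + \<bar>b\<bar>\<close>. For opposite signs \<open>u * v\<close> is the
  absolute difference of the squares, so the minimum equals half the sum of squares minus
  \<open>u * v / 2\<close>; otherwise \<open>u = v\<close> and that expression is at most 0.
  Weighted AM-GM then bounds \<open>u * v\<close> by terms that can be summed over edges, in place
  of Cauchy-Schwarz.\<close>

lemma min_squares_ge:
  fixes a b \<theta> :: real
  assumes "0 < \<theta>"
  shows "(1 - \<theta>) * (a\<^sup>2 + b\<^sup>2) / 2 - (a + b)\<^sup>2 / (4 * \<theta>) \<le> (if a * b < 0 then min (a\<^sup>2) (b\<^sup>2) else 0)"
proof -
  define u v where "u = \<bar>a + b\<bar>" and "v = \<bar>a\<bar> + \<bar>b\<bar>"
  have "0 \<le> (u - \<theta> * v)\<^sup>2 / (4 * \<theta>)" using assms by simp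
  also have "\<dots> = u\<^sup>2 / (4 * \<theta>) + \<theta> * v\<^sup>2 / 4 - u * v / 2"
    using assms by (simp add: field_simps power2_eq_square)
  finally have 1: "u * v / 2 \<le> (a + b)\<^sup>2 / (4 * \<theta>) + \<theta> * v\<^sup>2 / 4"
    by (simp add: u_def)
  have "v\<^sup>2 \<le> 2 * (a\<^sup>2 + b\<^sup>2)"
    using sum_squares_ge_zero[of "\<bar>a\<bar> - \<bar>b\<bar>" 0]
    by (simp add: v_def power2_eq_square algebra_simps)
  then have 2: "\<theta> * v\<^sup>2 / 4 \<le> \<theta> * (a\<^sup>2 + b\<^sup>2) / 2"
    using mult_left_mono[of "v\<^sup>2" "2 * (a\<^sup>2 + b\<^sup>2)" "\<theta>"] assms by simp
  have 3: "(a\<^sup>2 + b\<^sup>2) / 2 - u * v / 2 \<le> (if a * b < 0 then min (a\<^sup>2) (b\<^sup>2) else 0)"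
  proof (cases "a * b < 0")
    case True
    then have "v = \<bar>a - b\<bar>" by (auto simp: v_def mult_less_0_iff)
    then have "u * v = \<bar>a\<^sup>2 - b\<^sup>2\<bar>"
      by (simp add: u_def abs_mult[symmetric] power2_eq_square algebra_simps)
    then show ?thesis using True by (simp add: min_def abs_if field_simps)
  next
    case False
    then have "u = v" by (auto simp: u_def v_def not_less zero_le_mult_iff)
    then have "u * v = a\<^sup>2 + b\<^sup>2 + 2 * \<bar>a\<bar> * \<bar>b\<bar>"
      by (simp add: v_def power2_eq_square algebra_simps)
    then show ?thesis using False by simp
  qed
  show ?thesis using 1 2 3 by (simp add: algebra_simps diff_divide_distrib add_divide_distrib)
qed

section \<open>Regular graphs and the dual Cheeger sweep cut\<close>

locale regular_graph =
  fixes V :: "'a set" and E :: "('a \<times> 'a) set" and d :: nat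
  assumes finite_V: "finite V"
    and E_subset: "E \<subseteq> V \<times> V"
    and E_sym: "(x, y) \<in> E \<Longrightarrow> (y, x) \<in> E"
    and degree: "x \<in> V \<Longrightarrow> card (E `` {x}) = d"
begin

lemma finite_E: "finite E"
  using finite_subset[OF E_subset] finite_V by blast

lemma sum_E: "(\<Sum>(x, y)\<in>E. F x y) = (\<Sum>x\<in>V. \<Sum>y\<in>E `` {x}. F x y)" for F :: "'a \<Rightarrow> 'a \<Rightarrow> real"
proof -
  have "E = Sigma V (\<lambda>x. E `` {x})" using E_subset by auto
  moreover have "(\<Sum>(x, y)\<in>Sigma V (\<lambda>x. E `` {x}). F x y) = (\<Sum>x\<in>V. \<Sum>y\<in>E `` {x}. F x y)"
    by (rule sum.Sigma[symmetric]) (use finite_V finite_E in auto)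
  ultimately show ?thesis by simp
qed

lemma sum_E_swap: "(\<Sum>(x, y)\<in>E. F x y) = (\<Sum>(x, y)\<in>E. F y x)" for F :: "'a \<Rightarrow> 'a \<Rightarrow> real"
  by (rule sum.reindex_bij_witness[of _ prod.swap prod.swap]) (auto dest: E_sym)

lemma sum_E_fst: "(\<Sum>(x, y)\<in>E. h x) = d * (\<Sum>x\<in>V. h x)" for h :: "'a \<Rightarrow> real"
  by (simp add: sum_E degree sum_distrib_left)

lemma card_E_from: "X \<subseteq> V \<Longrightarrow> card {p \<in> E. fst p \<in> X} = d * card X"
proof -
  assume X: "X \<subseteq> V"
  have "{p \<in> E. fst p \<in> X} = Sigma X (\<lambda>x. E `` {x})" by auto
  moreover have "card (Sigma X (\<lambda>x. E `` {x})) = (\<Sum>x\<in>X. card (E `` {x}))"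
    by (rule card_SigmaI) (use X finite_V finite_subset finite_E in auto)
  moreover have "(\<Sum>x\<in>X. card (E `` {x})) = d * card X"
    using X degree by (simp add: subset_iff)
  ultimately show ?thesis by simp
qed

text \<open>Besides the edges inside one side this includes those leaving
  \<open>L \<union> R\<close>, so it also controls the edge boundary of
  \<open>L \<union> R\<close>.\<close>

definition frustrated :: "'a set \<Rightarrow> 'a set \<Rightarrow> ('a \<times> 'a) set" where
  "frustrated L R = {(x, y) \<in> E. x \<in> L \<and> y \<notin> R \<or> x \<in> R \<and> y \<notin> L}"

text \<open>The sweep cut of the dual Cheeger inequality: some level set of \<open>f\<^sup>2\<close>, split by the
  sign of \<open>f\<close>, is nearly a bipartition.\<close>

lemma ex_few_frustrated:
  fixes f :: "'a \<Rightarrow> real" and \<beta> \<delta> \<theta> :: real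
  assumes eig: "\<And>x. x \<in> V \<Longrightarrow> (\<Sum>y\<in>E `` {x}. f y) = d * (\<delta> - 1) * f x"
    and f_nz: "x\<^sub>0 \<in> V" "f x\<^sub>0 \<noteq> 0"
    and d: "0 < d" and \<theta>: "0 < \<theta>" and \<beta>: "\<theta> + \<delta> / (2 * \<theta>) < \<beta>"
  obtains L R where "L \<subseteq> V" "R \<subseteq> V" "L \<inter> R = {}"
    "real (card (frustrated L R)) < \<beta> * d * card (L \<union> R)"
proof -
  define q where "q = (\<Sum>x\<in>V. (f x)\<^sup>2)"
  have q: "0 < q" unfolding q_def
    by (rule sum_pos2[of V x\<^sub>0]) (use f_nz finite_V in auto)
  define P where "P = {(x, y) \<in> E. f x * f y < 0}"
  define w where "w = (\<lambda>(x, y). min ((f x)\<^sup>2) ((f y)\<^sup>2))"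
  have finP: "finite P" unfolding P_def by (rule finite_subset[OF _ finite_E]) auto
  have cross: "(\<Sum>(x, y)\<in>E. f x * f y) = d * (\<delta> - 1) * q"
    by (simp add: sum_E sum_distrib_left[symmetric] eig q_def)
       (simp add: sum_distrib_left algebra_simps power2_eq_square)
  have sq1: "(\<Sum>(x, y)\<in>E. (f x)\<^sup>2) = d * q" by (simp add: sum_E_fst q_def)
  have sq2: "(\<Sum>(x, y)\<in>E. (f y)\<^sup>2) = d * q" using sum_E_swap[of "\<lambda>x y. (f y)\<^sup>2"] sq1 by simp
  \<comment> \<open>The squares of \<open>f x + f y\<close> sum to
    \<open>2 * \<delta> * d * q\<close> over the edges, which produces the loss
    \<open>\<delta> / (2 * \<theta>)\<close>.\<close>
  have "(\<Sum>(x, y)\<in>E. (1 - \<theta>) * ((f x)\<^sup>2 + (f y)\<^sup>2) / 2 - (f x + f y)\<^sup>2 / (4 * \<theta>))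
      = (\<Sum>(x, y)\<in>E. ((1 - \<theta>) / 2 - 1 / (4 * \<theta>)) * (f x)\<^sup>2 + ((1 - \<theta>) / 2 - 1 / (4 * \<theta>)) * (f y)\<^sup>2
           - 1 / (2 * \<theta>) * (f x * f y))"
    using \<theta> by (intro sum.cong) (auto simp: field_simps power2_eq_square)
  also have "\<dots> = ((1 - \<theta>) / 2 - 1 / (4 * \<theta>)) * (\<Sum>(x, y)\<in>E. (f x)\<^sup>2)
      + ((1 - \<theta>) / 2 - 1 / (4 * \<theta>)) * (\<Sum>(x, y)\<in>E. (f y)\<^sup>2) - 1 / (2 * \<theta>) * (\<Sum>(x, y)\<in>E. f x * f y)"
    by (simp only: case_prod_unfold sum_subtractf sum.distrib sum_distrib_left[symmetric])
  also have "\<dots> = (1 - \<theta> - \<delta> / (2 * \<theta>)) * (d * q)"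
    unfolding sq1 sq2 cross using \<theta> by (simp add: field_simps)
  finally have "(1 - \<theta> - \<delta> / (2 * \<theta>)) * (d * q) \<le> (\<Sum>(x, y)\<in>E. if f x * f y < 0 then min ((f x)\<^sup>2) ((f y)\<^sup>2) else 0)"
    by (subst (asm) eq_commute) (auto intro!: sum_mono min_squares_ge \<theta>)
  also have "\<dots> = (\<Sum>p\<in>P. w p)"
    unfolding P_def w_def by (rule sum.mono_neutral_cong_right) (use finite_E in \<open>auto split: if_splits\<close>)
  finally have wP: "(1 - \<theta> - \<delta> / (2 * \<theta>)) * (d * q) \<le> (\<Sum>p\<in>P. w p)" .
  have "(1 - \<beta>) * (d * q) < (1 - \<theta> - \<delta> / (2 * \<theta>)) * (d * q)"
    by (rule mult_strict_right_mono) (use \<beta> d q in auto)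
  with wP have key: "(1 - \<beta>) * (d * q) < (\<Sum>p\<in>P. w p)" by simp
  \<comment> \<open>Vertices with weight \<open>(1 - \<beta>) * d\<close> and sign-changing edges
    with weight \<open>- 1\<close> form one weighted family, of negative total by
    \<open>key\<close>. The resulting threshold \<open>t\<close> has more than
    \<open>(1 - \<beta>) * d\<close> sign-changing edges per vertex above it.\<close>
  define b where "b = (\<lambda>i. case i of Inl x \<Rightarrow> (f x)\<^sup>2 | Inr p \<Rightarrow> w p)"
  define c :: "'a + 'a \<times> 'a \<Rightarrow> real"
    where "c = (\<lambda>i. case i of Inl x \<Rightarrow> (1 - \<beta>) * d | Inr p \<Rightarrow> - 1)"
  have "(\<Sum>i\<in>V <+> P. c i * b i) < 0"
    using key by (simp add: sum.Plus finite_V finP b_def c_def sum_distrib_left[symmetric] q_def sum_negf mult.assoc)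
  moreover have "0 \<le> b i" for i by (auto simp: b_def w_def split: sum.splits)
  ultimately obtain t where t: "0 \<le> t" "(\<Sum>i\<in>V <+> P. if t < b i then c i else 0) < 0"
    using layer_cake_nonneg[of "V <+> P" b c] finite_V finP by (meson finite_Plus not_le)
  define L where "L = {x \<in> V. t < (f x)\<^sup>2 \<and> 0 < f x}"
  define R where "R = {x \<in> V. t < (f x)\<^sup>2 \<and> f x < 0}"
  have X: "L \<union> R = {x \<in> V. t < (f x)\<^sup>2}"
    using t(1) by (auto simp: L_def R_def) (metis linorder_neqE_linordered_idom not_le power_zero_numeral)
  have s1: "(\<Sum>x\<in>V. if t < b (Inl x) then c (Inl x) else 0) = (1 - \<beta>) * d * card (L \<union> R)"
    unfolding X by (simp add: b_def c_def sum.inter_filter[symmetric] finite_V)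
  have s2: "(\<Sum>p\<in>P. if t < b (Inr p) then c (Inr p) else 0) = - real (card {p \<in> P. t < w p})"
    by (simp add: b_def c_def sum.inter_filter[symmetric] finP)
  have less: "(1 - \<beta>) * real d * card (L \<union> R) < card {p \<in> P. t < w p}"
    using t(2) by (simp add: sum.Plus finite_V finP s1 s2 comp_def)
  \<comment> \<open>A sign-changing edge with \<open>t < w p\<close> has both ends above the
    threshold, hence joins \<open>L\<close> and \<open>R\<close>.\<close>
  have "frustrated L R \<subseteq> {p \<in> E. fst p \<in> L \<union> R} - {p \<in> P. t < w p}"
    using E_subset by (auto simp: frustrated_def L_def R_def P_def w_def mult_less_0_iff)
  then have "card (frustrated L R) \<le> card ({p \<in> E. fst p \<in> L \<union> R} - {p \<in> P. t < w p})"
    by (rule card_mono[rotated]) (use finite_E in auto)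
  also have "\<dots> = card {p \<in> E. fst p \<in> L \<union> R} - card {p \<in> P. t < w p}"
    by (rule card_Diff_subset) (use finP E_subset X in \<open>auto simp: P_def w_def\<close>)
  finally have "card (frustrated L R) \<le> card {p \<in> E. fst p \<in> L \<union> R} - card {p \<in> P. t < w p}" .
  moreover have "card {p \<in> P. t < w p} \<le> card {p \<in> E. fst p \<in> L \<union> R}"
    by (rule card_mono) (use finite_E E_subset X in \<open>auto simp: P_def w_def\<close>)
  moreover have "card {p \<in> E. fst p \<in> L \<union> R} = d * card (L \<union> R)"
    by (rule card_E_from) (auto simp: L_def R_def)
  ultimately have "real (card (frustrated L R)) \<le> real d * card (L \<union> R) - real (card {p \<in> P. t < w p})"
    by (simp add: of_nat_diff flip: of_nat_mult)
  with less have "real (card (frustrated L R)) < \<beta> * d * card (L \<union> R)"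
    by (simp add: algebra_simps)
  moreover have "L \<subseteq> V" "R \<subseteq> V" "L \<inter> R = {}" by (auto simp: L_def R_def)
  ultimately show thesis using that by blast
qed

lemma finite_frustrated: "finite (frustrated L R)"
  by (rule finite_subset[OF _ finite_E]) (auto simp: frustrated_def)

text \<open>An edge from \<open>L\<close> that is not frustrated ends in \<open>R\<close>, so its
  reversal is one of the \<open>d * card R\<close> edges starting in \<open>R\<close>.\<close>

lemma card_diff_le_frustrated:
  assumes "L \<subseteq> V" "R \<subseteq> V" "L \<inter> R = {}"
  shows "d * card L \<le> d * card R + card (frustrated L R)"
proof -
  have "{p \<in> E. fst p \<in> L} \<subseteq> prod.swap ` {p \<in> E. fst p \<in> R} \<union> frustrated L R"
  proof
    fix p assume "p \<in> {p \<in> E. fst p \<in> L}"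
    moreover obtain x y where "p = (x, y)" by force
    ultimately show "p \<in> prod.swap ` {p \<in> E. fst p \<in> R} \<union> frustrated L R"
      using E_sym[of x y] image_eqI[of p prod.swap "(y, x)" "{p \<in> E. fst p \<in> R}"]
      by (cases "y \<in> R") (auto simp: frustrated_def)
  qed
  moreover have fin: "finite {p \<in> E. fst p \<in> R}" "finite (frustrated L R)"
    by (auto simp: frustrated_def intro: finite_subset[OF _ finite_E])
  ultimately have "card {p \<in> E. fst p \<in> L} \<le> card (prod.swap ` {p \<in> E. fst p \<in> R} \<union> frustrated L R)"
    by (intro card_mono) auto
  also have "\<dots> \<le> card (prod.swap ` {p \<in> E. fst p \<in> R}) + card (frustrated L R)"
    by (rule card_Un_le)
  also have "card (prod.swap ` {p \<in> E. fst p \<in> R}) \<le> card {p \<in> E. fst p \<in> R}"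
    by (rule card_image_le[OF fin(1)])
  finally show ?thesis using card_E_from assms by simp
qed

end

section \<open>Almost invariant sets and subgroups of index two\<close>

context group
begin

text \<open>Substitute \<open>y = inv g \<otimes> x\<close>, so that
  \<open>g = x \<otimes> inv y\<close>. With \<open>D\<close> the whole group the count is the
  square of \<open>card L\<close>; with \<open>D\<close> the complement of a subgroup it counts
  pairs in different right cosets.\<close>

lemma card_translates_inter:
  assumes fin: "finite (carrier G)" and L: "L \<subseteq> carrier G" and D: "D \<subseteq> carrier G"
  shows "(\<Sum>g\<in>D. card {x \<in> L. inv g \<otimes> x \<in> L}) = card {(x, y) \<in> L \<times> L. x \<otimes> inv y \<in> D}"
proof -
  have finL: "finite L" and finD: "finite D" using fin L D finite_subset by auto
  have "(\<Sum>g\<in>D. card {x \<in> L. inv g \<otimes> x \<in> L}) = card (Sigma D (\<lambda>g. {x \<in> L. inv g \<otimes> x \<in> L}))"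
    by (rule card_SigmaI[symmetric]) (use finL finD in auto)
  also have "\<dots> = card {(x, y) \<in> L \<times> L. x \<otimes> inv y \<in> D}"
  proof (rule bij_betw_same_card[OF bij_betw_byWitness[
        where f = "\<lambda>(g, x). (x, inv g \<otimes> x)" and f' = "\<lambda>(x, y). (x \<otimes> inv y, x)"]])
    show "\<forall>p\<in>Sigma D (\<lambda>g. {x \<in> L. inv g \<otimes> x \<in> L}).
        (\<lambda>(x, y). (x \<otimes> inv y, x)) ((\<lambda>(g, x). (x, inv g \<otimes> x)) p) = p"
      using L D by (auto simp: inv_mult_group m_assoc[symmetric] subset_iff)
    show "\<forall>p\<in>{(x, y) \<in> L \<times> L. x \<otimes> inv y \<in> D}.
        (\<lambda>(g, x). (x, inv g \<otimes> x)) ((\<lambda>(x, y). (x \<otimes> inv y, x)) p) = p"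
      using L D by (auto simp: inv_mult_group m_assoc subset_iff)
    show "(\<lambda>(g, x). (x, inv g \<otimes> x)) ` Sigma D (\<lambda>g. {x \<in> L. inv g \<otimes> x \<in> L})
        \<subseteq> {(x, y) \<in> L \<times> L. x \<otimes> inv y \<in> D}"
      using L D by (auto simp: inv_mult_group m_assoc[symmetric] subset_iff)
    show "(\<lambda>(x, y). (x \<otimes> inv y, x)) ` {(x, y) \<in> L \<times> L. x \<otimes> inv y \<in> D}
        \<subseteq> Sigma D (\<lambda>g. {x \<in> L. inv g \<otimes> x \<in> L})"
      using L D by (auto simp: inv_mult_group m_assoc subset_iff)
  qed
  finally show ?thesis .
qed

text \<open>Translation by \<open>inv x\<close> injects \<open>H\<close> into its complement, which
  has the same size, so \<open>y = inv x \<otimes> h\<close> for some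
  \<open>h \<in> H\<close>.\<close>

lemma index_two_mult:
  assumes fin: "finite (carrier G)" and H: "subgroup H G" and card: "2 * card H = card (carrier G)"
    and x: "x \<in> carrier G - H" and y: "y \<in> carrier G - H"
  shows "x \<otimes> y \<in> H"
proof -
  have HG: "H \<subseteq> carrier G" using H by (rule subgroup.subset)
  have inj: "inj_on (\<lambda>h. inv x \<otimes> h) H"
    by (rule inj_onI) (use HG x in \<open>auto simp: subset_iff\<close>)
  have "(\<lambda>h. inv x \<otimes> h) ` H \<subseteq> carrier G - H"
  proof clarify
    fix h assume h: "h \<in> H"
    have "x \<in> H" if "inv x \<otimes> h \<in> H"
    proof -
      have "h \<otimes> inv (inv x \<otimes> h) \<in> H"
        by (rule subgroup.m_closed[OF H h subgroup.m_inv_closed[OF H that]])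
      then show ?thesis using x h HG by (auto simp: inv_mult_group m_assoc[symmetric] subset_iff)
    qed
    then show "inv x \<otimes> h \<in> carrier G - H" using x h HG by auto
  qed
  moreover have "card ((\<lambda>h. inv x \<otimes> h) ` H) = card (carrier G - H)"
    using card card_image[OF inj] card_Diff_subset[of H "carrier G"] HG fin finite_subset by fastforce
  ultimately have "(\<lambda>h. inv x \<otimes> h) ` H = carrier G - H"
    by (intro card_subset_eq) (use fin in auto)
  then obtain h where "h \<in> H" "y = inv x \<otimes> h" using y by auto
  then show ?thesis using x HG by (auto simp: m_assoc[symmetric] subset_iff)
qed

text \<open>The elements whose translate of \<open>L\<close> meets \<open>L\<close> in almost everything form a subgroup, whose order
  is found by double counting.\<close>

lemma near_coset:
  fixes L :: "'a set"
  defines "N \<equiv> real (card (carrier G))"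
    and "w \<equiv> \<lambda>g. real (card {x \<in> L. inv g \<otimes> x \<in> L})"
  assumes fin: "finite (carrier G)" and L: "L \<subseteq> carrier G"
    and lower: "49 / 100 * N \<le> card L" and upper: "card L \<le> 51 / 100 * N"
    and dich: "\<And>g. g \<in> carrier G \<Longrightarrow> w g \<le> 3 / 100 * N \<or> 46 / 100 * N \<le> w g"
  obtains H K where "subgroup H G" "2 * card H = card (carrier G)"
    "K = H \<or> K = carrier G - H" "card (K - L) \<le> 8 / 100 * N"
proof -
  have finL: "finite L" using fin L finite_subset by auto
  have N: "0 < N" using fin by (auto simp: N_def card_gt_0_iff)
  define H where "H = {g \<in> carrier G. 46 / 100 * N \<le> w g}"
  have HG: "H \<subseteq> carrier G" by (auto simp: H_def)
  have finH: "finite H" using fin HG finite_subset by auto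
  have notH: "w g \<le> 3 / 100 * N" if "g \<in> carrier G - H" for g
    using dich that by (auto simp: H_def)
  \<comment> \<open>The gap in \<open>dich\<close> means that any overlap above 3 percent already
    gives membership; this makes \<open>H\<close> closed under products.\<close>
  have inH: "g \<in> H" if "g \<in> carrier G" "3 / 100 * N < w g" for g
    using dich[OF that(1)] that by (auto simp: H_def)
  have w_le: "w g \<le> card L" for g
    unfolding w_def by (simp add: card_mono finL)
  have sub: "subgroup H G"
  proof (rule subgroup.intro)
    show "H \<subseteq> carrier G" by (rule HG)
    have "{x \<in> L. inv \<one> \<otimes> x \<in> L} = L" using L by auto
    then show "\<one> \<in> H" using lower N by (intro inH) (auto simp: w_def)
    show "inv g \<in> H" if "g \<in> H" for g
    proof -
      have g: "g \<in> carrier G" using that HG by auto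
      have "bij_betw (\<lambda>x. inv g \<otimes> x) {x \<in> L. inv g \<otimes> x \<in> L} {x \<in> L. inv (inv g) \<otimes> x \<in> L}"
        by (rule bij_betw_byWitness[where f' = "\<lambda>x. g \<otimes> x"])
           (use g L in \<open>auto simp: m_assoc[symmetric] subset_iff\<close>)
      then have "w (inv g) = w g" unfolding w_def by (simp add: bij_betw_same_card)
      then show ?thesis using that g by (auto simp: H_def)
    qed
    show "g \<otimes> h \<in> H" if "g \<in> H" "h \<in> H" for g h
    proof -
      have g: "g \<in> carrier G" and h: "h \<in> carrier G" using that HG by auto
      \<comment> \<open>\<open>A\<close> and \<open>C\<close> each fill at least 46 percent of the
        group inside \<open>L\<close>, which fills at most 51 percent. They share at least 41
        percent, and \<open>g\<close> carries \<open>A \<inter> C\<close> into the overlap of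
        \<open>L\<close> with its translate by \<open>g \<otimes> h\<close>.\<close>
      define A where "A = (\<lambda>x. inv g \<otimes> x) ` {x \<in> L. inv g \<otimes> x \<in> L}"
      define C where "C = {x \<in> L. inv h \<otimes> x \<in> L}"
      have "inj_on (\<lambda>x. inv g \<otimes> x) {x \<in> L. inv g \<otimes> x \<in> L}"
        by (rule inj_onI) (use g L in \<open>auto simp: subset_iff\<close>)
      then have cA: "card A = w g" by (simp add: A_def w_def card_image)
      have cC: "card C = w h" by (simp add: C_def w_def)
      have AL: "A \<subseteq> L" and CL: "C \<subseteq> L" by (auto simp: A_def C_def)
      have finAC: "finite A" "finite C" using AL CL finL finite_subset by auto
      have "card (A \<union> C) \<le> card L" using AL CL finL by (intro card_mono) auto
      moreover have "card A + card C = card (A \<union> C) + card (A \<inter> C)"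
        using finAC by (rule card_Un_Int)
      ultimately have AC: "w g + w h - card L \<le> card (A \<inter> C)" using cA cC by linarith
      have "inj_on (\<lambda>x. g \<otimes> x) (A \<inter> C)"
        by (rule inj_onI) (use g L AL in \<open>auto simp: subset_iff\<close>)
      moreover have "(\<lambda>x. g \<otimes> x) ` (A \<inter> C) \<subseteq> {x \<in> L. inv (g \<otimes> h) \<otimes> x \<in> L}"
      proof clarify
        fix z assume z: "z \<in> A" "z \<in> C"
        then obtain x where x: "x \<in> L" "z = inv g \<otimes> x" by (auto simp: A_def)
        have [simp]: "x \<in> carrier G" "z \<in> carrier G" using x z L AL by auto
        have "g \<otimes> z = x" using x g by (simp add: m_assoc[symmetric])
        moreover have "inv (g \<otimes> h) \<otimes> (g \<otimes> z) = inv h \<otimes> (inv g \<otimes> (g \<otimes> z))"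
          using g h by (simp add: inv_mult_group m_assoc)
        moreover have "inv g \<otimes> (g \<otimes> z) = z" using g by (simp add: m_assoc[symmetric])
        ultimately show "g \<otimes> z \<in> L \<and> inv (g \<otimes> h) \<otimes> (g \<otimes> z) \<in> L"
          using x z by (simp add: C_def)
      qed
      ultimately have "card (A \<inter> C) \<le> card {x \<in> L. inv (g \<otimes> h) \<otimes> x \<in> L}"
        by (intro card_inj_on_le) (use finL in auto)
      then have "w g + w h - card L \<le> w (g \<otimes> h)" using AC by (simp add: w_def)
      moreover have "46 / 100 * N \<le> w g" "46 / 100 * N \<le> w h" using that by (auto simp: H_def)
      ultimately show ?thesis using g h upper N by (intro inH) auto
    qed
  qed
  define l where "l = real (card L)"
  have "{(x, y) \<in> L \<times> L. x \<otimes> inv y \<in> carrier G} = L \<times> L" using L by auto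
  then have total: "(\<Sum>g\<in>carrier G. w g) = l * l"
    using card_translates_inter[OF fin L order_refl]
    by (simp add: w_def l_def card_cartesian_product flip: of_nat_sum of_nat_mult)
  have split: "(\<Sum>g\<in>carrier G. w g) = (\<Sum>g\<in>H. w g) + (\<Sum>g\<in>carrier G - H. w g)"
    using sum.subset_diff[OF HG fin, of w] by simp
  have out_le: "(\<Sum>g\<in>carrier G - H. w g) \<le> real (card (carrier G - H)) * (3 / 100 * N)"
    using sum_bounded_above[of "carrier G - H" w "3 / 100 * N"] notH by simp
  have cout: "real (card (carrier G - H)) = N - card H"
    using card_Diff_subset[OF finH HG] card_mono[OF fin HG] by (simp add: N_def of_nat_diff)
  have "(\<Sum>g\<in>H. w g) \<le> card H * l"
    using sum_bounded_above[of H w l] w_le by (simp add: l_def)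
  moreover have "(N - card H) * (3 / 100 * N) \<le> 3 / 100 * (N * N)"
    using N by (simp add: algebra_simps)
  ultimately have up: "l * l \<le> card H * l + 3 / 100 * (N * N)"
    using total split out_le unfolding cout by linarith
  have "card H * (46 / 100 * N) \<le> (\<Sum>g\<in>H. w g)"
    using sum_bounded_below[of H "46 / 100 * N" w] by (simp add: H_def)
  moreover have "0 \<le> (\<Sum>g\<in>carrier G - H. w g)" by (rule sum_nonneg) (simp add: w_def)
  ultimately have low: "card H * (46 / 100 * N) \<le> l * l" using total split by simp
  \<comment> \<open>Both bounds on \<open>card H\<close> come from comparing the two estimates with
    \<open>l * l\<close>: order at most \<open>N / 3\<close> would give 0.49 * 0.15 <= 0.03, and
    order \<open>N\<close> would give 0.46 <= 0.51 * 0.51. Lagrange then leaves only index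
    two.\<close>
  have H3: "N < 3 * card H"
  proof (rule ccontr)
    assume "\<not> N < 3 * card H"
    then have "49 / 100 * N * (15 / 100 * N) \<le> l * (l - card H)"
      using lower N by (intro mult_mono) (auto simp: l_def)
    then show False using up mult_pos_pos[OF N N] by (simp add: algebra_simps)
  qed
  have H1: "card H < N"
  proof (rule ccontr)
    assume "\<not> card H < N"
    then have "N * (46 / 100 * N) \<le> card H * (46 / 100 * N)"
      using N by (intro mult_right_mono) auto
    moreover have "l * l \<le> (51 / 100 * N) * (51 / 100 * N)"
      using upper N by (intro mult_mono) (auto simp: l_def)
    ultimately show False using low mult_pos_pos[OF N N] by (simp add: algebra_simps)
  qed
  define k where "k = card (rcosets H)"
  have lag: "k * card H = card (carrier G)"
    using lagrange[OF sub] by (simp add: k_def Coset.order_def)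
  have "k = 2"
  proof -
    have "k \<noteq> 0" using lag N by (intro notI) (simp add: N_def)
    moreover have "k \<noteq> 1" using lag H1 by (auto simp: N_def)
    moreover have "k < 3"
    proof (rule ccontr)
      assume "\<not> k < 3"
      then have "3 * card H \<le> k * card H" by (intro mult_right_mono) auto
      then show False using lag H3 by (simp add: N_def)
    qed
    ultimately show ?thesis by linarith
  qed
  then have half: "2 * card H = card (carrier G)" using lag by simp
  then have halfN: "card H = N / 2" unfolding N_def by linarith
  define p where "p = real (card (L \<inter> H))"
  define q where "q = real (card (L - H))"
  have pq: "p + q = l"
  proof -
    have "card L = card (L \<inter> H) + card (L - H)"
      using card_Un_disjoint[of "L \<inter> H" "L - H"] finL by (simp add: Int_Diff_disjoint Int_Diff_Un)
    then show ?thesis by (simp add: p_def q_def l_def)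
  qed
  \<comment> \<open>Elements of \<open>L\<close> on different sides of \<open>H\<close> have
    quotient outside \<open>H\<close>, where overlaps are small. So \<open>L\<close> cannot occupy a
    large part of both cosets.\<close>
  have "p * q \<le> (\<Sum>g\<in>carrier G - H. w g)"
  proof -
    have "x \<otimes> inv y \<in> carrier G - H" if *: "x \<in> L" "x \<in> H" "y \<in> L" "y \<notin> H" for x y
    proof -
      have [simp]: "x \<in> carrier G" "y \<in> carrier G" using * L by auto
      have "y \<in> H" if "x \<otimes> inv y \<in> H"
      proof -
        have "inv (x \<otimes> inv y) \<otimes> x \<in> H"
          by (rule subgroup.m_closed[OF sub subgroup.m_inv_closed[OF sub that] *(2)])
        then show ?thesis by (simp add: inv_mult_group m_assoc)
      qed
      then show ?thesis using * by auto
    qed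
    then have "(L \<inter> H) \<times> (L - H) \<subseteq> {(x, y) \<in> L \<times> L. x \<otimes> inv y \<in> carrier G - H}"
      by blast
    then have "card ((L \<inter> H) \<times> (L - H)) \<le> card {(x, y) \<in> L \<times> L. x \<otimes> inv y \<in> carrier G - H}"
      by (rule card_mono[rotated]) (rule finite_subset[of _ "L \<times> L"], use finL in auto)
    also have "\<dots> = (\<Sum>g\<in>carrier G - H. card {x \<in> L. inv g \<otimes> x \<in> L})"
      by (rule card_translates_inter[symmetric]) (use fin L in auto)
    finally show ?thesis
      by (simp add: w_def p_def q_def card_cartesian_product flip: of_nat_sum of_nat_mult)
  qed
  then have pq_le: "p * q \<le> 15 / 1000 * (N * N)" using out_le cout halfN by simp
  \<comment> \<open>Otherwise the larger part is at least 0.245 \<open>N\<close>, and 0.245 * 0.07 >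
    0.015. The larger part is then at least 0.42 \<open>N\<close>, so its coset exceeds
    \<open>L\<close> by at most 0.08 \<open>N\<close>.\<close>
  have small: "b \<le> 7 / 100 * N" if "a + b = l" "a \<ge> b" "0 \<le> b" "a * b \<le> 15 / 1000 * (N * N)" for a b
  proof (rule ccontr)
    assume "\<not> b \<le> 7 / 100 * N"
    then have "(245 / 1000 * N) * (7 / 100 * N) \<le> a * b"
      using that lower N by (intro mult_mono) (auto simp: l_def)
    then show False using that mult_pos_pos[OF N N] by (simp add: algebra_simps)
  qed
  have diff1: "real (card (H - L)) = N / 2 - p"
    using card_Diff_subset_Int[of H L] finH card_mono[of H "L \<inter> H"] halfN
    by (simp add: p_def of_nat_diff Int_commute)
  have "(carrier G - H) \<inter> L = L - H" using L by auto
  then have diff2: "real (card ((carrier G - H) - L)) = N / 2 - q"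
    using card_Diff_subset_Int[of "carrier G - H" L] fin finL card_mono[of "carrier G - H" "L - H"]
      Diff_mono[OF L order_refl] halfN cout
    by (simp add: q_def of_nat_diff)
  show thesis
  proof (cases "p \<ge> q")
    case True
    then have "q \<le> 7 / 100 * N" using small[of p q] pq pq_le by (simp add: q_def)
    then show thesis using that[OF sub half, of H] diff1 pq lower by (simp add: l_def)
  next
    case False
    then have "p \<le> 7 / 100 * N" using small[of q p] pq pq_le by (simp add: p_def mult.commute add.commute)
    then show thesis using that[OF sub half, of "carrier G - H"] diff2 pq lower by (simp add: l_def)
  qed
qed

end

section \<open>Cayley sum graphs: symmetries, expansion and the bipartition\<close>

locale cayley_sum = group G for G (structure) +
  fixes S :: "'a set"
  assumes finite_G: "finite (carrier G)"
    and S_subset: "S \<subseteq> carrier G"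
    and S_conj: "conj_closed G S"
begin

abbreviation "E \<equiv> cayley_sum_graph G S"

text \<open>The product of the new endpoints is the conjugate of \<open>x \<otimes> y\<close> by
  \<open>g\<close>; this is where closure of \<open>S\<close> under conjugation enters.\<close>

lemma edge_conj:
  assumes "(x, y) \<in> E" "g \<in> carrier G"
  shows "(g \<otimes> x, y \<otimes> inv g) \<in> E"
proof -
  have xy: "x \<in> carrier G" "y \<in> carrier G" "x \<otimes> y \<in> S"
    using assms by (auto simp: cayley_sum_graph_def)
  then have "g \<otimes> (x \<otimes> y) \<otimes> inv g \<in> S" using S_conj assms(2) by (auto simp: conj_closed_def)
  then show ?thesis using xy assms(2) by (simp add: cayley_sum_graph_def m_assoc)
qed

lemma edge_shift:
  assumes "(x, y) \<in> E" "g \<in> carrier G"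
  shows "(x \<otimes> g, inv g \<otimes> y) \<in> E"
proof -
  have xy: "x \<in> carrier G" "y \<in> carrier G" "x \<otimes> y \<in> S"
    using assms by (auto simp: cayley_sum_graph_def)
  have "x \<otimes> g \<otimes> (inv g \<otimes> y) = x \<otimes> (g \<otimes> inv g) \<otimes> y"
    using xy(1,2) assms(2) by (simp only: m_assoc m_closed inv_closed)
  then show ?thesis using xy assms(2) by (simp add: cayley_sum_graph_def)
qed

text \<open>Adjacency is symmetric because \<open>y \<otimes> x\<close> is the conjugate of
  \<open>x \<otimes> y\<close> by \<open>y\<close>; regularity holds because left multiplication by
  \<open>x\<close> maps the neighbours of \<open>x\<close> bijectively onto
  \<open>S\<close>.\<close>

sublocale regular_graph "carrier G" E "card S"
proof
  show "finite (carrier G)" by (rule finite_G)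
  show "E \<subseteq> carrier G \<times> carrier G" by (auto simp: cayley_sum_graph_def)
  show "(y, x) \<in> E" if "(x, y) \<in> E" for x y
  proof -
    have "x \<in> carrier G" "y \<in> carrier G" using that by (auto simp: cayley_sum_graph_def)
    then show ?thesis using edge_conj[OF that, of y] edge_shift[OF that, of "inv x"]
      edge_conj[OF that, of "inv x"] by (simp add: cayley_sum_graph_def)
  qed
  show "card (E `` {x}) = card S" if x: "x \<in> carrier G" for x
  proof -
    have "bij_betw (\<lambda>y. x \<otimes> y) (E `` {x}) S"
      by (rule bij_betw_byWitness[where f' = "\<lambda>s. inv x \<otimes> s"])
         (use x S_subset in \<open>auto simp: cayley_sum_graph_def m_assoc[symmetric] subset_iff\<close>)
    then show ?thesis by (rule bij_betw_same_card)
  qed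
qed

definition edge_boundary :: "'a set \<Rightarrow> ('a \<times> 'a) set" where
  "edge_boundary Z = {(x, y) \<in> E. x \<in> Z \<and> y \<notin> Z}"

lemma finite_edge_boundary: "finite (edge_boundary Z)"
  by (rule finite_subset[OF _ finite_E]) (auto simp: edge_boundary_def)

lemma neighbours_subset:
  assumes "X \<subseteq> carrier G"
  shows "set_inv X <#> S \<subseteq> E `` X"
proof
  fix y assume "y \<in> set_inv X <#> S"
  then obtain x s where xs: "x \<in> X" "s \<in> S" "y = inv x \<otimes> s"
    by (auto simp: set_mult_def SET_INV_def)
  then have "(x, y) \<in> E"
    using assms S_subset by (auto simp: cayley_sum_graph_def m_assoc[symmetric] subset_iff)
  then show "y \<in> E `` X" using xs(1) by blast
qed

text \<open>For a small set, each outside neighbour is the end of a boundary edge. For a large set,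
  vertex expansion is applied to the complement, and each vertex of \<open>X\<close> it reaches
  starts a boundary edge.\<close>

lemma expander_boundary:
  assumes "cayley_sum_vertex_expander G S \<epsilon>" and X: "X \<subseteq> carrier G"
  shows "2 * card X \<le> card (carrier G) \<Longrightarrow> \<epsilon> * card X \<le> card (edge_boundary X)"
    and "card (carrier G) \<le> 2 * card X \<Longrightarrow>
      \<epsilon> * (real (card (carrier G)) - card X) \<le> card (edge_boundary X)"
proof -
  have expand: "\<epsilon> * card Y \<le> card (E `` Y - Y)"
    if Y: "Y \<subseteq> carrier G" "2 * card Y \<le> card (carrier G)" for Y
  proof (cases "Y = {}")
    case False
    have "real (card Y) \<le> 1 / 2 * real (card (carrier G))" using Y(2) by linarith
    then have "\<epsilon> * card Y \<le> card ((set_inv Y <#> S) - Y)"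
      using assms(1) Y False unfolding cayley_sum_vertex_expander_def by blast
    also have "card ((set_inv Y <#> S) - Y) \<le> card (E `` Y - Y)"
      using neighbours_subset[OF Y(1)] finite_E by (intro card_mono) auto
    finally show ?thesis by simp
  qed simp
  show "\<epsilon> * card X \<le> card (edge_boundary X)" if "2 * card X \<le> card (carrier G)"
  proof -
    have "E `` X - X \<subseteq> snd ` edge_boundary X" by (force simp: edge_boundary_def)
    then have "card (E `` X - X) \<le> card (edge_boundary X)"
      by (rule surj_card_le[OF finite_edge_boundary])
    then show ?thesis using expand[OF X that] by linarith
  qed
  show "\<epsilon> * (real (card (carrier G)) - card X) \<le> card (edge_boundary X)"
    if "card (carrier G) \<le> 2 * card X"
  proof -
    let ?Y = "carrier G - X"
    have Y: "card ?Y = card (carrier G) - card X" "card X \<le> card (carrier G)"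
      using card_Diff_subset[OF finite_subset[OF X finite_G] X] card_mono[OF finite_G X] by simp_all
    have "E `` ?Y - ?Y \<subseteq> fst ` edge_boundary X"
    proof
      fix x assume x: "x \<in> E `` ?Y - ?Y"
      then obtain y where y: "y \<in> ?Y" "(y, x) \<in> E" by blast
      have "x \<in> X" using x y(2) E_subset by blast
      then have "(x, y) \<in> edge_boundary X"
        using y E_sym[OF y(2)] by (simp add: edge_boundary_def)
      then show "x \<in> fst ` edge_boundary X" by (rule image_eqI[rotated]) simp
    qed
    then have "card (E `` ?Y - ?Y) \<le> card (edge_boundary X)"
      by (rule surj_card_le[OF finite_edge_boundary])
    moreover have "2 * card ?Y \<le> card (carrier G)" using Y that by linarith
    then have "\<epsilon> * card ?Y \<le> card (E `` ?Y - ?Y)" by (intro expand) auto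
    ultimately have "\<epsilon> * card ?Y \<le> card (edge_boundary X)" by linarith
    then show ?thesis using Y by (simp add: of_nat_diff)
  qed
qed

text \<open>The bipartite double cover of the Cayley sum graph admits the automorphisms acting by
  \<open>x \<mapsto> g x\<close> on one side and by \<open>y \<mapsto> y g\<inverse>\<close> on the other.\<close>

lemma boundary_translate:
  assumes L: "L \<subseteq> carrier G" and R: "R \<subseteq> carrier G" and g: "g \<in> carrier G"
  shows "card (edge_boundary ({x \<in> L. inv g \<otimes> x \<in> L} \<union> {y \<in> R. y \<otimes> g \<in> R}))
    \<le> 3 * card (frustrated L R)"
proof -
  let ?F = "frustrated L R"
  define a where "a = (\<lambda>(x, y). (g \<otimes> x, y \<otimes> inv g))"
  define b where "b = (\<lambda>(x, y). (x \<otimes> inv g, g \<otimes> y))"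
  \<comment> \<open>Suppose \<open>x \<in> L\<close> and \<open>inv g \<otimes> x \<in> L\<close>.
    If neither \<open>(x, y)\<close> nor \<open>(inv g \<otimes> x, y \<otimes> g)\<close> is
    frustrated, then \<open>y\<close> and \<open>y \<otimes> g\<close> lie in \<open>R\<close>, so
    the edge does not leave the set. For \<open>x \<in> R\<close> the pair
    \<open>(x \<otimes> g, inv g \<otimes> y)\<close> plays the same role. Hence three copies of the
    frustrated set cover the boundary.\<close>
  have "edge_boundary ({x \<in> L. inv g \<otimes> x \<in> L} \<union> {y \<in> R. y \<otimes> g \<in> R}) \<subseteq> ?F \<union> (a ` ?F \<union> b ` ?F)"
  proof clarify
    fix x y
    assume bd: "(x, y) \<in> edge_boundary ({x \<in> L. inv g \<otimes> x \<in> L} \<union> {y \<in> R. y \<otimes> g \<in> R})"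
      and na: "(x, y) \<notin> ?F" and nb: "(x, y) \<notin> b ` ?F"
    have xy: "(x, y) \<in> E" "x \<in> carrier G" "y \<in> carrier G"
      using bd by (auto simp: edge_boundary_def cayley_sum_graph_def)
    have ea: "(inv g \<otimes> x, y \<otimes> g) \<in> E" using edge_conj[OF xy(1), of "inv g"] g by simp
    have eb: "(x \<otimes> g, inv g \<otimes> y) \<in> E" using edge_shift[OF xy(1) g] .
    have pa: "(x, y) = a (inv g \<otimes> x, y \<otimes> g)"
      using xy g by (simp add: a_def m_assoc) (simp add: m_assoc[symmetric])
    have pb: "(x, y) = b (x \<otimes> g, inv g \<otimes> y)"
      using xy g by (simp add: b_def m_assoc) (simp add: m_assoc[symmetric])
    have "(x \<otimes> g, inv g \<otimes> y) \<notin> ?F" using nb pb by (metis image_eqI)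
    then have "(inv g \<otimes> x, y \<otimes> g) \<in> ?F"
      using bd na ea eb by (auto simp: edge_boundary_def frustrated_def)
    then show "(x, y) \<in> a ` ?F" using pa by (rule image_eqI[rotated])
  qed
  then have "card (edge_boundary ({x \<in> L. inv g \<otimes> x \<in> L} \<union> {y \<in> R. y \<otimes> g \<in> R}))
      \<le> card (?F \<union> (a ` ?F \<union> b ` ?F))"
    by (rule card_mono[rotated]) (use finite_frustrated in auto)
  also have "\<dots> \<le> card ?F + (card (a ` ?F) + card (b ` ?F))"
    using card_Un_le[of ?F "a ` ?F \<union> b ` ?F"] card_Un_le[of "a ` ?F" "b ` ?F"] by linarith
  also have "\<dots> \<le> 3 * card ?F"
    using card_image_le[OF finite_frustrated, of a L R] card_image_le[OF finite_frustrated, of b L R]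
    by linarith
  finally show ?thesis .
qed

text \<open>Test expansion on a set of half the vertices, rounded down: its complement is at most
  twice as large.\<close>

lemma expander_le_two:
  assumes "cayley_sum_vertex_expander G S \<epsilon>" and "2 \<le> card (carrier G)"
  shows "\<epsilon> \<le> 2"
proof -
  obtain X where X: "X \<subseteq> carrier G" "card X = card (carrier G) div 2"
    using obtain_subset_with_card_n[of "card (carrier G) div 2" "carrier G"] by auto
  have pos: "0 < card X" and le: "real (card X) \<le> 1 / 2 * real (card (carrier G))"
    and twice: "card (carrier G) - card X \<le> 2 * card X"
    using X assms(2) by linarith+
  have "X \<noteq> {}" using pos by auto
  then have "\<epsilon> * card X \<le> card ((set_inv X <#> S) - X)"
    using assms(1) X(1) le unfolding cayley_sum_vertex_expander_def by blast
  also have "card ((set_inv X <#> S) - X) \<le> card (carrier G - X)"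
    using neighbours_subset[OF X(1)] E_subset finite_G by (intro card_mono) auto
  also have "card (carrier G - X) \<le> 2 * card X"
    using twice card_Diff_subset[OF finite_subset[OF X(1) finite_G] X(1)] by simp
  finally have "\<epsilon> * card X \<le> 2 * real (card X)" by simp
  then show ?thesis using pos by simp
qed

lemma bipartite_if_few_frustrated:
  assumes exp: "cayley_sum_vertex_expander G S \<epsilon>" and \<epsilon>: "0 < \<epsilon>" "\<epsilon> \<le> 2" and S3: "3 \<le> card S"
    and L: "L \<subseteq> carrier G" and R: "R \<subseteq> carrier G" and LR: "L \<inter> R = {}"
    and few: "card (frustrated L R) < \<epsilon> / 100 * card (L \<union> R)"
  shows "bipartite (carrier G) E"
proof -
  define N where "N = real (card (carrier G))"
  define F where "F = real (card (frustrated L R))"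
  have finL: "finite L" and finR: "finite R" using L R finite_G finite_subset by auto
  have card_LR: "card (L \<union> R) = card L + card R" using finL finR LR by (rule card_Un_disjoint)
  have X_le: "card (L \<union> R) \<le> N"
    unfolding N_def using L R finite_G by (simp add: card_mono)
  have "\<epsilon> / 100 * card (L \<union> R) \<le> \<epsilon> / 100 * N" using X_le \<epsilon> by (intro mult_left_mono) auto
  then have F_less: "F < \<epsilon> / 100 * N" using few by (simp add: F_def)
  have N: "0 < N" using finite_G by (auto simp: N_def card_gt_0_iff)
  have "\<epsilon> / 100 * N \<le> 2 / 100 * N" using \<epsilon> N by (intro mult_right_mono) auto
  then have F_small: "F < 2 / 100 * N" using F_less by linarith
  have "edge_boundary (L \<union> R) \<subseteq> frustrated L R" by (auto simp: edge_boundary_def frustrated_def)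
  then have bd: "card (edge_boundary (L \<union> R)) \<le> F"
    unfolding F_def by (simp add: card_mono finite_frustrated)
  have X: "L \<union> R \<subseteq> carrier G" using L R by simp
  \<comment> \<open>The boundary of \<open>L \<union> R\<close> is a hundred times too small for a
    set below half size, so expansion bounds the complement instead, by
    \<open>N / 100\<close>.\<close>
  have "\<not> 2 * card (L \<union> R) \<le> card (carrier G)"
  proof
    assume "2 * card (L \<union> R) \<le> card (carrier G)"
    then have "\<epsilon> * card (L \<union> R) < \<epsilon> / 100 * card (L \<union> R)"
      using expander_boundary(1)[OF exp X] bd few by (simp add: F_def)
    moreover have "0 \<le> \<epsilon> * card (L \<union> R)" using \<epsilon> by simp
    ultimately show False by linarith
  qed
  then have "\<epsilon> * (N - card (L \<union> R)) < \<epsilon> * (N / 100)"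
    using expander_boundary(2)[OF exp X] bd F_less by (simp add: N_def)
  then have X_ge: "99 / 100 * N \<le> card L + card R" using \<epsilon> card_LR by simp
  \<comment> \<open>An imbalance above 1 percent would, at degree at least 3, force 3 percent of
    \<open>N\<close> frustrated edges, but there are fewer than 2 percent.\<close>
  have balance: "card A \<le> card B + 1 / 100 * N"
    if "card S * card A \<le> card S * card B + card (frustrated L R)" for A B :: "'a set"
  proof (rule ccontr)
    assume *: "\<not> card A \<le> card B + 1 / 100 * N"
    have "real (card S) * card A \<le> card S * card B + F"
      using that unfolding F_def by (metis of_nat_add of_nat_le_iff of_nat_mult)
    then have "card S * (real (card A) - card B) \<le> F" by (simp add: algebra_simps)
    moreover have "3 * (1 / 100 * N) \<le> card S * (real (card A) - card B)"
      using S3 * N by (intro mult_mono) auto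
    ultimately show False using F_small N by simp
  qed
  have "frustrated R L = frustrated L R" by (auto simp: frustrated_def)
  then have bal: "card L \<le> card R + 1 / 100 * N" "card R \<le> card L + 1 / 100 * N"
    using balance card_diff_le_frustrated[OF L R LR] card_diff_le_frustrated[OF R L] LR
    by (auto simp: Int_commute)
  have bounds: "49 / 100 * N \<le> card L" "card L \<le> 51 / 100 * N" "card R \<le> 51 / 100 * N"
    using bal X_ge X_le card_LR by auto
  \<comment> \<open>The union \<open>?A \<union> ?B\<close> has less than 3 or more than 97 percent
    of the vertices. In the second case \<open>?B\<close>, being inside \<open>R\<close>, accounts
    for at most 51 percent, which leaves 46 for \<open>?A\<close>.\<close>
  have dich: "card {x \<in> L. inv g \<otimes> x \<in> L} \<le> 3 / 100 * N \<or> 46 / 100 * N \<le> card {x \<in> L. inv g \<otimes> x \<in> L}"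
    if g: "g \<in> carrier G" for g
  proof -
    let ?A = "{x \<in> L. inv g \<otimes> x \<in> L}" and ?B = "{y \<in> R. y \<otimes> g \<in> R}"
    have AB: "?A \<union> ?B \<subseteq> carrier G" using L R by auto
    have "card (edge_boundary (?A \<union> ?B)) \<le> 3 * F"
      using boundary_translate[OF L R g] unfolding F_def by linarith
    then have bd_AB: "card (edge_boundary (?A \<union> ?B)) < \<epsilon> * (3 / 100 * N)" using F_less by simp
    show ?thesis
    proof (cases "2 * card (?A \<union> ?B) \<le> card (carrier G)")
      case True
      then have "\<epsilon> * card (?A \<union> ?B) < \<epsilon> * (3 / 100 * N)"
        using expander_boundary(1)[OF exp AB] bd_AB by linarith
      then have "card (?A \<union> ?B) < 3 / 100 * N" using \<epsilon>(1) by (simp only: mult_less_cancel_left_pos)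
      moreover have "card ?A \<le> card (?A \<union> ?B)" using finL finR by (intro card_mono) auto
      ultimately show ?thesis by linarith
    next
      case False
      then have "\<epsilon> * (N - card (?A \<union> ?B)) < \<epsilon> * (3 / 100 * N)"
        using expander_boundary(2)[OF exp AB] bd_AB unfolding N_def by linarith
      then have "N - card (?A \<union> ?B) < 3 / 100 * N" using \<epsilon>(1) by (simp only: mult_less_cancel_left_pos)
      moreover have "card (?A \<union> ?B) \<le> card ?A + card ?B" by (rule card_Un_le)
      moreover have "card ?B \<le> card R" using finR by (intro card_mono) auto
      ultimately show ?thesis using bounds(3) by linarith
    qed
  qed
  obtain H K where H: "subgroup H G" and half: "2 * card H = card (carrier G)"
    and K: "K = H \<or> K = carrier G - H" and KL: "card (K - L) \<le> 8 / 100 * N"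
    by (rule near_coset[OF finite_G L bounds(1,2)[unfolded N_def] dich[unfolded N_def]])
       (auto simp: N_def)
  have HG: "H \<subseteq> carrier G" using H by (rule subgroup.subset)
  have finH: "finite H" using HG finite_G finite_subset by auto
  have KG: "K \<subseteq> carrier G" using K HG by auto
  have finK: "finite K" using KG finite_G finite_subset by auto
  have "2 * card K = card (carrier G)"
    using K half card_Diff_subset[OF finH HG] by auto
  then have cK: "card K = N / 2" unfolding N_def by linarith
  \<comment> \<open>For \<open>s\<close> in \<open>S \<inter> H\<close> the edges from
    \<open>x\<close> to \<open>inv x \<otimes> s\<close> stay inside \<open>K\<close>. Unless an end
    lies in \<open>K - L\<close> such an edge is frustrated, so \<open>K\<close> would have fewer
    than (0.02 + 2 * 0.08) \<open>N\<close> elements instead of \<open>N / 2\<close>.\<close>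
  have disj: "S \<inter> H = {}"
  proof (rule ccontr)
    assume "S \<inter> H \<noteq> {}"
    then obtain s where s: "s \<in> S" "s \<in> H" by auto
    have sG: "s \<in> carrier G" using s HG by auto
    have invK: "inv x \<otimes> s \<in> K" if "x \<in> K" for x
    proof -
      have x: "x \<in> carrier G" using that KG by auto
      have "inv x \<otimes> s \<in> H \<longleftrightarrow> x \<in> H"
      proof
        assume *: "inv x \<otimes> s \<in> H"
        have "s \<otimes> inv (inv x \<otimes> s) \<in> H"
          by (rule subgroup.m_closed[OF H s(2) subgroup.m_inv_closed[OF H *]])
        then show "x \<in> H" using x sG by (simp add: inv_mult_group m_assoc[symmetric])
      next
        assume "x \<in> H"
        then show "inv x \<otimes> s \<in> H"
          by (intro subgroup.m_closed[OF H] subgroup.m_inv_closed[OF H] s(2))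
      qed
      then show ?thesis using K that x sG by auto
    qed
    \<comment> \<open>\<open>a\<close> recovers \<open>x\<close> from its neighbour
      \<open>inv x \<otimes> s\<close>.\<close>
    define a where "a = (\<lambda>y. s \<otimes> inv y)"
    have "K \<subseteq> fst ` frustrated L R \<union> ((K - L) \<union> a ` (K - L))"
    proof
      fix x assume x: "x \<in> K"
      have xG: "x \<in> carrier G" using x KG by auto
      have e: "(x, inv x \<otimes> s) \<in> E"
        using xG sG s by (simp add: cayley_sum_graph_def m_assoc[symmetric])
      have "x = a (inv x \<otimes> s)" using xG sG by (simp add: a_def inv_mult_group m_assoc[symmetric])
      moreover have "x = fst (x, inv x \<otimes> s)" by simp
      moreover have "(x, inv x \<otimes> s) \<in> frustrated L R" if "x \<in> L" "inv x \<otimes> s \<in> L"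
        using that e LR by (auto simp: frustrated_def)
      ultimately show "x \<in> fst ` frustrated L R \<union> ((K - L) \<union> a ` (K - L))"
        using invK[OF x] x by (metis DiffI UnCI image_eqI)
    qed
    then have "card K \<le> card (fst ` frustrated L R \<union> ((K - L) \<union> a ` (K - L)))"
      by (rule card_mono[rotated]) (use finK finite_frustrated in auto)
    also have "\<dots> \<le> card (fst ` frustrated L R) + (card (K - L) + card (a ` (K - L)))"
      using card_Un_le[of "fst ` frustrated L R" "(K - L) \<union> a ` (K - L)"]
        card_Un_le[of "K - L" "a ` (K - L)"] by linarith
    also have "\<dots> \<le> card (frustrated L R) + 2 * card (K - L)"
      using card_image_le[OF finite_frustrated, of fst L R] card_image_le[of "K - L" a] finK by simp
    finally have "card K \<le> F + 2 * real (card (K - L))" unfolding F_def by linarith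
    then show False using cK KL F_small N by simp
  qed
  have "E \<inter> H \<times> H = {}"
    using disj subgroup.m_closed[OF H] by (auto simp: cayley_sum_graph_def)
  moreover have "E \<inter> (carrier G - H) \<times> (carrier G - H) = {}"
    using disj index_two_mult[OF finite_G H half] by (auto simp: cayley_sum_graph_def)
  ultimately show ?thesis
    unfolding bipartite_def using HG by (intro exI[of _ H] exI[of _ "carrier G - H"]) auto
qed

end

section \<open>From matrix eigenvalues to the spectral bound\<close>

lemma eigenvalue_adjacency_function:
  assumes e: "bij_betw e {0..<n} V" and E: "E \<subseteq> V \<times> V" and d: "0 < d"
    and eig: "eigenvalue (normalised_adjacency_mat d n e E) \<mu>"
  obtains f x\<^sub>0 where "x\<^sub>0 \<in> V" "f x\<^sub>0 \<noteq> 0" "\<And>x. x \<in> V \<Longrightarrow> (\<Sum>y\<in>E `` {x}. f y) = real d * \<mu> * f x"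
proof -
  let ?A = "normalised_adjacency_mat d n e E"
  have dim: "dim_row ?A = n" by (simp add: normalised_adjacency_mat_def adjacency_mat_def)
  obtain v where v: "v \<in> carrier_vec n" "v \<noteq> 0\<^sub>v n" "?A *\<^sub>v v = \<mu> \<cdot>\<^sub>v v"
    using eig unfolding eigenvalue_def eigenvector_def dim by auto
  define f where "f = (\<lambda>x. v $ inv_into {0..<n} e x)"
  have fe: "f (e i) = v $ i" if "i < n" for i
    using that e by (simp add: f_def bij_betw_def inv_into_f_f)
  have eV: "e i \<in> V" if "i < n" for i using that e by (auto simp: bij_betw_def)
  obtain k where k: "k < n" "v $ k \<noteq> 0"
    using v(1,2) by (metis carrier_vecD eq_vecI index_zero_vec)
  have finV: "finite V" using e bij_betw_finite by blast
  have "(\<Sum>y\<in>E `` {x}. f y) = real d * \<mu> * f x" if x: "x \<in> V" for x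
  proof -
    obtain i where i: "i < n" "x = e i" using x e by (auto simp: bij_betw_def)
    have "\<mu> * v $ i = (?A *\<^sub>v v) $ i" using v i by simp
    also have "\<dots> = (\<Sum>j = 0..<n. 1 / real d * (if (e i, e j) \<in> E then 1 else 0) * v $ j)"
      using i v(1) by (simp add: normalised_adjacency_mat_def adjacency_mat_def scalar_prod_def)
    also have "\<dots> = 1 / real d * (\<Sum>j = 0..<n. if (x, e j) \<in> E then f (e j) else 0)"
      unfolding sum_distrib_left by (rule sum.cong) (auto simp: i fe)
    also have "(\<Sum>j = 0..<n. if (x, e j) \<in> E then f (e j) else 0) = (\<Sum>y\<in>V. if (x, y) \<in> E then f y else 0)"
      by (rule sum.reindex_bij_betw[OF e])
    also have "\<dots> = (\<Sum>y\<in>{y \<in> V. (x, y) \<in> E}. f y)"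
      by (rule sum.inter_filter[OF finV, symmetric])
    also have "{y \<in> V. (x, y) \<in> E} = E `` {x}" using E by auto
    finally show ?thesis using d fe[OF i(1)] i by (simp add: field_simps)
  qed
  then show thesis using that[of "e k" f] k fe eV by auto
qed

theorem theorem3p2:
  fixes G :: "('a, 'b) monoid_scheme"
    and S :: "'a set"
    and d d\<^sub>0 \<kappa> :: nat
    and \<epsilon> \<mu> :: real
    and e :: "nat \<Rightarrow> 'a"
  assumes "group G" and "finite (carrier G)"
    and "symmetric_subset G S"
    and "generate G S = carrier G"
    and "\<one>\<^bsub>G\<^esub> \<notin> S"
    and "conj_closed G S"
    and "card S = d"
    and "\<epsilon> > 0"
    and "cayley_sum_vertex_expander G S \<epsilon>"
    and "\<not> bipartite (carrier G) (cayley_sum_graph G S)"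
    and "\<not> (\<exists>T. symmetric_subset G T \<and> T \<noteq> {} \<and> T \<subset> S \<and> generate G T = carrier G)"
    and "(\<kappa>, d\<^sub>0) \<in> {(477, 3), (330, 4), (257, 5), (214, 6), (187, 7), (167, 8), (153, 9), (142, 10)}"
    and "d \<ge> d\<^sub>0"
    and "bij_betw e {0..<card (carrier G)} (carrier G)"
    and "eigenvalue (normalised_adjacency_mat d (card (carrier G)) e (cayley_sum_graph G S)) \<mu>"
  shows "\<mu> > - 1 + \<epsilon> ^ 4 / (real \<kappa> * real d ^ 8)"
proof (rule ccontr)
  assume "\<not> \<mu> > - 1 + \<epsilon> ^ 4 / (real \<kappa> * real d ^ 8)"
  then have \<mu>: "\<mu> + 1 \<le> \<epsilon> ^ 4 / (real \<kappa> * real d ^ 8)" by simp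
  have S: "S \<subseteq> carrier G" using assms(3) by (simp add: symmetric_subset_def)
  interpret group G by (rule assms(1))
  interpret cayley_sum G S by unfold_locales (use assms(2,6) S in auto)
  \<comment> \<open>The eight pairs are treated at once through their common bounds on
    \<open>d\<close> and \<open>\<kappa>\<close>.\<close>
  have d3: "3 \<le> d" and \<kappa>: "142 \<le> \<kappa>" using assms(12,13) by auto
  have "d \<le> card (carrier G)" using card_mono[OF assms(2) S] assms(7) by simp
  then have \<epsilon>2: "\<epsilon> \<le> 2" using expander_le_two[OF assms(9)] d3 by simp
  \<comment> \<open>The sweep cut must achieve \<open>\<beta> = \<epsilon> / (100 * d)\<close>;
    taking \<open>\<theta>\<close> to be half of it reduces the requirement to
    \<open>\<mu> + 1 < 2 * \<theta> * \<theta>\<close>.\<close>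
  define \<theta> where "\<theta> = \<epsilon> / (200 * d)"
  have \<theta>: "0 < \<theta>" using assms(8) d3 by (simp add: \<theta>_def)
  have small: "\<theta> + (\<mu> + 1) / (2 * \<theta>) < \<epsilon> / (100 * d)"
  proof -
    have "\<epsilon> ^ 4 / (real \<kappa> * real d ^ 8) \<le> \<epsilon> ^ 4 / (142 * real d ^ 8)"
      using \<kappa> d3 by (intro divide_left_mono mult_right_mono) auto
    with \<mu> have "\<mu> + 1 \<le> \<epsilon> ^ 4 / (142 * real d ^ 8)" by simp
    also have "\<dots> < 2 * \<theta> * \<theta>"
    proof -
      \<comment> \<open>After clearing denominators the claim is
        \<open>20000 * \<epsilon> ^ 2 < 142 * real d ^ 6\<close>; the worst case
        \<open>\<epsilon> = 2\<close>, \<open>d = 3\<close> reads 80000 < 103518.\<close>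
      have "\<epsilon> ^ 2 \<le> 2 ^ 2" using \<epsilon>2 assms(8) by (intro power_mono) auto
      moreover have "(3::real) ^ 6 \<le> real d ^ 6" using d3 by (intro power_mono) auto
      ultimately have "20000 * \<epsilon> ^ 2 < 142 * real d ^ 6" by simp
      then have "20000 * \<epsilon> ^ 2 * (\<epsilon> ^ 2 * real d ^ 2) < 142 * real d ^ 6 * (\<epsilon> ^ 2 * real d ^ 2)"
        using assms(8) d3 by (intro mult_strict_right_mono) auto
      then have "20000 * \<epsilon> ^ 4 * real d ^ 2 < \<epsilon> ^ 2 * (142 * real d ^ 8)"
        by (simp add: power_add[symmetric] mult.assoc mult.left_commute flip: power_add)
      then show ?thesis using d3 by (simp add: \<theta>_def field_simps power2_eq_square)
    qed
    finally have "(\<mu> + 1) / (2 * \<theta>) < \<theta>" using \<theta> by (simp add: field_simps)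
    then show ?thesis by (simp add: \<theta>_def)
  qed
  obtain f x\<^sub>0 where f: "x\<^sub>0 \<in> carrier G" "f x\<^sub>0 \<noteq> 0"
    "\<And>x. x \<in> carrier G \<Longrightarrow> (\<Sum>y\<in>E `` {x}. f y) = real d * \<mu> * f x"
    by (rule eigenvalue_adjacency_function[OF assms(14) E_subset _ assms(15)]) (use d3 in auto)
  obtain L R where LR: "L \<subseteq> carrier G" "R \<subseteq> carrier G" "L \<inter> R = {}"
    "real (card (frustrated L R)) < \<epsilon> / (100 * d) * d * card (L \<union> R)"
    using ex_few_frustrated[of f "\<mu> + 1" x\<^sub>0 \<theta> "\<epsilon> / (100 * d)"] f \<theta> small d3 assms(7)
    by auto
  have "bipartite (carrier G) E"
    by (rule bipartite_if_few_frustrated[OF assms(9,8) \<epsilon>2 _ LR(1-3)])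
       (use LR(4) d3 assms(7) in auto)
  then show False using assms(10) by simp
qed

end
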